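(* Let $A$ be a finite-dimensional Leibniz algebra over an algebraically closed field $\mathbb{F}$ of characteristic zero in which each left multiplication operator $L_a$, $a\in A$, is nilpotent. Then $A$ is nilpotent.
   Context: A (left) Leibniz algebra over $\mathbb{F}$ is an $\mathbb{F}$-vector space $A$ with a bilinear map $[\,,\,]:A\times A\to A$ satisfying $[a,[b,c]]=[[a,b],c]+[b,[a,c]]$ for all $a,b,c\in A$. For $a\in A$, $L_a:A\to A$ is defined by $L_a(b)=[a,b]$. $A$ is nilpotent if there is an integer $c$ such that every product of $c+1$ elements of $A$ (with any bracketing) is $0$. *)

theory Defs
  imports "HOL-Computational_Algebra.Polynomial"
begin

(* The carrier of the algebra is the whole type 'b; "linear" in each argument is the library
   notion relative to the scalar multiplication "scale". *)

locale leibniz_algebra = vector_space scale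
  for scale :: "'a::field \<Rightarrow> 'b::ab_group_add \<Rightarrow> 'b" +
  fixes br :: "'b \<Rightarrow> 'b \<Rightarrow> 'b"
  assumes linear_right: "Vector_Spaces.linear scale scale (\<lambda>b. br a b)"
    and linear_left: "Vector_Spaces.linear scale scale (\<lambda>a. br a b)"
    and leibniz_identity: "br a (br b c) = br (br a b) c + br b (br a c)"

definition finite_dim :: "('a::field \<Rightarrow> 'b::ab_group_add \<Rightarrow> 'b) \<Rightarrow> bool" where
  "finite_dim scale \<longleftrightarrow> (\<exists>S. finite S \<and> module.span scale S = UNIV)"

definition left_mult :: "('b \<Rightarrow> 'b \<Rightarrow> 'b) \<Rightarrow> 'b \<Rightarrow> 'b \<Rightarrow> 'b" where
  "left_mult br a = (\<lambda>b. br a b)"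

definition nilpotent_op :: "('b::zero \<Rightarrow> 'b) \<Rightarrow> bool" where
  "nilpotent_op f \<longleftrightarrow> (\<exists>n. f ^^ n = (\<lambda>_. 0))"

(* "product_of br n x": x is the value of a product of n elements under some bracketing. *)

inductive product_of :: "('b \<Rightarrow> 'b \<Rightarrow> 'b) \<Rightarrow> nat \<Rightarrow> 'b \<Rightarrow> bool"
  for br :: "'b \<Rightarrow> 'b \<Rightarrow> 'b" where
  single: "product_of br 1 a"
| bracket: "product_of br m x \<Longrightarrow> product_of br n y \<Longrightarrow> product_of br (m + n) (br x y)"

definition nilpotent_algebra :: "('b::zero \<Rightarrow> 'b \<Rightarrow> 'b) \<Rightarrow> bool" where
  "nilpotent_algebra br \<longleftrightarrow> (\<exists>c::nat. \<forall>x. product_of br (c + 1) x \<longrightarrow> x = 0)"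

end

(* Following the classical proof of Engel's theorem, take a subalgebra B of maximal dimension among
   those that contain the left kernel K = {x. L_x = 0} and whose left multiplications act nilpotently
   on the whole algebra. If B were proper, the last term not contained in B of the descending series
   V_0 = A, V_(i+1) = [B, V_i] would provide an a outside B with [B, a] in B. Left Leibniz algebras
   are anticommutative modulo K, so B + Fa is again a subalgebra; L_a preserves each V_i, and if
   L_a^m = 0 then any m left multiplications by elements of B + Fa map V_i into V_(i+1), so B + Fa
   acts nilpotently, against maximality. Hence B = A and all long right-normed products vanish; by
   the Leibniz identity every product is a combination of right-normed ones. *)

theory Submission
  imports Defs
begin

context leibniz_algebra
begin

section \<open>Bilinearity of the bracket and the subspaces it defines\<close>

lemma br_add_right: "br a (x + y) = br a x + br a y"
  and br_scale_right: "br a (scale c x) = scale c (br a x)"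
  using linear_right[of a, unfolded linear_iff_module_hom]
  by (auto dest: module_hom.add module_hom.scale)

lemma br_add_left: "br (x + y) a = br x a + br y a"
  and br_scale_left: "br (scale c x) a = scale c (br x a)"
  using linear_left[of a, unfolded linear_iff_module_hom]
  by (auto dest: module_hom.add module_hom.scale)

lemma br_zero_right [simp]: "br a 0 = 0"
  using br_scale_right[of a 0 0] by simp

lemma br_zero_left [simp]: "br 0 a = 0"
  using br_scale_left[of 0 0 a] by simp

lemma subspace_vimage_br: "subspace W \<Longrightarrow> subspace {x. br a x \<in> W}"
  by (auto simp: subspace_def br_add_right br_scale_right)

lemma subspace_vimage_br_left: "subspace W \<Longrightarrow> subspace {x. br x a \<in> W}"
  by (auto simp: subspace_def br_add_left br_scale_left)

text \<open>The set is the sum \<open>L_a^k V + W\<close>. Such sums interpolate between consecutive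
  terms of \<open>left_series\<close> when \<open>a\<close> is adjoined to a subalgebra.\<close>

lemma subspace_left_mult_power_image:
  assumes "subspace V" "subspace W"
  shows "subspace {x. \<exists>v\<in>V. x - (left_mult br a ^^ k) v \<in> W}"
proof -
  have add: "(left_mult br a ^^ k) (x + y) = (left_mult br a ^^ k) x + (left_mult br a ^^ k) y" for x y
    by (induction k) (auto simp: left_mult_def br_add_right)
  have scale: "(left_mult br a ^^ k) (scale c x) = scale c ((left_mult br a ^^ k) x)" for c x
    by (induction k) (auto simp: left_mult_def br_scale_right)
  show ?thesis
  proof (rule subspaceI)
    have "(left_mult br a ^^ k) 0 = 0"
      using scale[of 0 0] by simp
    then show "0 \<in> {x. \<exists>v\<in>V. x - (left_mult br a ^^ k) v \<in> W}"
      using assms by (auto intro!: bexI[of _ 0] simp: subspace_0)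
  next
    fix x y
    assume "x \<in> {x. \<exists>v\<in>V. x - (left_mult br a ^^ k) v \<in> W}"
      and "y \<in> {x. \<exists>v\<in>V. x - (left_mult br a ^^ k) v \<in> W}"
    then obtain v w where "v \<in> V" "w \<in> V" "x - (left_mult br a ^^ k) v \<in> W"
        "y - (left_mult br a ^^ k) w \<in> W"
      by blast
    moreover from this have "x + y - (left_mult br a ^^ k) (v + w) \<in> W"
      using subspace_add[OF assms(2)] by (fastforce simp: add algebra_simps)
    ultimately show "x + y \<in> {x. \<exists>v\<in>V. x - (left_mult br a ^^ k) v \<in> W}"
      using subspace_add[OF assms(1)] by blast
  next
    fix c x
    assume "x \<in> {x. \<exists>v\<in>V. x - (left_mult br a ^^ k) v \<in> W}"
    then obtain v where "v \<in> V" "x - (left_mult br a ^^ k) v \<in> W"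
      by blast
    then have "scale c v \<in> V" "scale c x - (left_mult br a ^^ k) (scale c v) \<in> W"
      using assms subspace_scale by (auto simp: scale simp flip: scale_right_diff_distrib)
    then show "scale c x \<in> {x. \<exists>v\<in>V. x - (left_mult br a ^^ k) v \<in> W}"
      by blast
  qed
qed

section \<open>The descending series of iterated left multiplications by a set\<close>

primrec left_series :: "'b set \<Rightarrow> nat \<Rightarrow> 'b set" where
  "left_series B 0 = UNIV"
| "left_series B (Suc n) = span {br b v | b v. b \<in> B \<and> v \<in> left_series B n}"

lemma subspace_left_series: "subspace (left_series B n)"
  by (cases n) auto

lemma left_series_br: "b \<in> B \<Longrightarrow> v \<in> left_series B n \<Longrightarrow> br b v \<in> left_series B (Suc n)"
  by (auto intro: span_base)

lemma left_series_Suc_subset: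
  assumes "subspace W" "\<And>b v. b \<in> B \<Longrightarrow> v \<in> left_series B n \<Longrightarrow> br b v \<in> W"
  shows "left_series B (Suc n) \<subseteq> W"
  unfolding left_series.simps using assms by (intro span_minimal) auto

lemma left_series_decreasing: "left_series B (Suc n) \<subseteq> left_series B n"
proof (induction n)
  case (Suc n)
  then show ?case
    using left_series_br by (intro left_series_Suc_subset subspace_left_series) blast
qed simp

text \<open>By the Leibniz identity \<open>L_a\<close> is a derivation: \<open>br a (br b v)\<close>
  splits into a term with \<open>br a b\<close> in \<open>B\<close> and a term with
  \<open>br a v\<close>, which induction controls.\<close>

lemma left_series_br_normalizer:
  assumes "\<And>b. b \<in> B \<Longrightarrow> br a b \<in> B" "v \<in> left_series B n"
  shows "br a v \<in> left_series B n"
  using assms(2)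
proof (induction n arbitrary: v)
  case (Suc n)
  have "left_series B (Suc n) \<subseteq> {v. br a v \<in> left_series B (Suc n)}"
  proof (rule left_series_Suc_subset)
    fix b v assume "b \<in> B" "v \<in> left_series B n"
    then show "br b v \<in> {v. br a v \<in> left_series B (Suc n)}"
      using subspace_add[OF subspace_left_series] assms(1) left_series_br Suc.IH
      by (simp only: mem_Collect_eq leibniz_identity[of a b v])
  qed (intro subspace_vimage_br subspace_left_series)
  with Suc.prems show ?case by blast
qed simp

lemma left_series_span_insert:
  assumes B: "subspace B" and norm: "\<And>b. b \<in> B \<Longrightarrow> br a b \<in> B"
    and m: "left_mult br a ^^ m = (\<lambda>_. 0)"
  shows "left_series (span (insert a B)) (i * m) \<subseteq> left_series B i"
proof (induction i)
  case (Suc i)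
  define C where "C = span (insert a B)"
  \<comment> \<open>With \<open>V_i\<close> for \<open>left_series B i\<close>, \<open>P k\<close>
    is \<open>L_a^k V_i + V_(i+1)\<close>; it bounds what \<open>k\<close> further multiplications
    by \<open>C\<close> leave of \<open>V_i\<close>.\<close>
  define P where "P = (\<lambda>k. {x. \<exists>v\<in>left_series B i.
    x - (left_mult br a ^^ k) v \<in> left_series B (Suc i)})"
  note inv = left_series_br_normalizer[OF norm]
  have power: "(left_mult br a ^^ k) v \<in> left_series B i" if "v \<in> left_series B i" for k v
    using that by (induction k) (auto simp: left_mult_def intro: inv)
  have "left_series C (i * m + k) \<subseteq> P k" for k
  proof (induction k)
    case 0
    then show ?case
      using Suc.IH subspace_0[OF subspace_left_series[of B "Suc i"]]
      by (force simp: P_def C_def simp del: left_series.simps)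
  next
    case (Suc k)
    have "left_series C (Suc (i * m + k)) \<subseteq> P (Suc k)"
    proof (rule left_series_Suc_subset)
      show "subspace (P (Suc k))"
        unfolding P_def by (intro subspace_left_mult_power_image subspace_left_series)
    next
      fix c x assume c: "c \<in> C" and "x \<in> left_series C (i * m + k)"
      with Suc obtain v where v: "v \<in> left_series B i"
          and u: "x - (left_mult br a ^^ k) v \<in> left_series B (Suc i)"
        unfolding P_def by blast
      define u where "u = x - (left_mult br a ^^ k) v"
      have x: "x = u + (left_mult br a ^^ k) v"
        by (simp add: u_def)
      have "x \<in> left_series B i"
        unfolding x using u left_series_decreasing power[OF v]
        by (intro subspace_add[OF subspace_left_series]) (auto simp only: u_def)
      \<comment> \<open>\<open>C = B + Fa\<close>, so \<open>c\<close> is an element of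
        \<open>B\<close> plus a multiple of \<open>a\<close>.\<close>
      moreover obtain s where b: "c - scale s a \<in> B"
        using c B by (auto simp: C_def span_breakdown_eq span_subspace[OF subset_refl span_superset])
      ultimately have "br (c - scale s a) x \<in> left_series B (Suc i)"
        by (rule left_series_br[rotated])
      moreover have "scale s (br a u) \<in> left_series B (Suc i)"
        using u inv subspace_scale[OF subspace_left_series] by (simp only: u_def)
      ultimately have "br (c - scale s a) x + scale s (br a u) \<in> left_series B (Suc i)"
        by (rule subspace_add[OF subspace_left_series])
      \<comment> \<open>Modulo \<open>V_(i+1)\<close> the \<open>B\<close>-component of
        \<open>c\<close> kills \<open>x\<close>, and \<open>L_a\<close> keeps \<open>u\<close> in
        \<open>V_(i+1)\<close>. Hence \<open>br c x\<close> is congruent to \<open>L_a^(k+1)\<close>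
        of \<open>scale s v\<close>, the witness for \<open>P (Suc k)\<close>.\<close>
      moreover have "(left_mult br a ^^ Suc k) (scale s v) = scale s (br a ((left_mult br a ^^ k) v))"
      proof -
        have "(left_mult br a ^^ k) (scale s v) = scale s ((left_mult br a ^^ k) v)"
          by (induction k) (auto simp: left_mult_def br_scale_right)
        then show ?thesis
          by (simp add: left_mult_def br_scale_right)
      qed
      moreover have "br c x = br (c - scale s a) x + scale s (br a x)"
        using br_add_left[of "c - scale s a" "scale s a" x] by (simp add: br_scale_left)
      moreover have "br a x = br a u + br a ((left_mult br a ^^ k) v)"
        by (subst x) (rule br_add_right)
      ultimately have "br c x - (left_mult br a ^^ Suc k) (scale s v) \<in> left_series B (Suc i)"
        by (simp add: scale_right_distrib algebra_simps del: left_series.simps funpow.simps)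
      moreover have "scale s v \<in> left_series B i"
        using v by (rule subspace_scale[OF subspace_left_series])
      ultimately show "br c x \<in> P (Suc k)"
        unfolding P_def by blast
    qed
    then show ?case by simp
  qed
  \<comment> \<open>At \<open>k = m\<close> the summand \<open>L_a^m V_i\<close> is zero, so
    \<open>P m\<close> is just \<open>V_(i+1)\<close>.\<close>
  from this[of m] show ?case
    by (auto simp: P_def C_def m add.commute simp del: left_series.simps)
qed simp

section \<open>The left kernel and subalgebras acting nilpotently\<close>

definition left_kernel :: "'b set" where
  "left_kernel = {x. \<forall>y. br x y = 0}"

text \<open>Add the Leibniz identities for \<open>x, y\<close> and for \<open>y, x\<close>: the
  doubly nested terms cancel.\<close>

lemma br_anticommute_left_kernel: "br x y + br y x \<in> left_kernel"
  using leibniz_identity[of x y] leibniz_identity[of y x]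
  by (simp add: left_kernel_def br_add_left)

lemma br_self_left_kernel: "br x x \<in> left_kernel"
  using leibniz_identity[of x x] by (simp add: left_kernel_def)

text \<open>Including \<open>left_kernel\<close> makes the bracket anticommutative modulo
  \<open>B\<close>. The series starts at the whole algebra, so nilpotency concerns the action on all
  of it.\<close>

definition nil_subalgebra :: "'b set \<Rightarrow> bool" where
  "nil_subalgebra B \<longleftrightarrow> subspace B \<and> left_kernel \<subseteq> B \<and> (\<forall>x\<in>B. \<forall>y\<in>B. br x y \<in> B) \<and>
    (\<exists>n. left_series B n \<subseteq> {0})"

lemma nil_subalgebra_left_kernel: "nil_subalgebra left_kernel"
proof -
  have "subspace left_kernel"
    by (auto simp: subspace_def left_kernel_def br_add_left br_scale_left)
  moreover have left_kernel_br: "br x y \<in> left_kernel" if "x \<in> left_kernel" for x y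
    using that by (auto simp: left_kernel_def)
  moreover have "left_series left_kernel 1 \<subseteq> {0}"
    unfolding One_nat_def by (rule left_series_Suc_subset) (auto simp: left_kernel_def)
  ultimately show ?thesis
    unfolding nil_subalgebra_def by (blast intro: left_kernel_br)
qed

lemma nil_subalgebra_extend:
  assumes nil: "nil_subalgebra B" and "B \<noteq> UNIV"
    and nilp: "\<And>a. nilpotent_op (left_mult br a)"
  obtains C where "nil_subalgebra C" "B \<subset> C"
proof -
  have B: "subspace B" "left_kernel \<subseteq> B" "\<And>x y. x \<in> B \<Longrightarrow> y \<in> B \<Longrightarrow> br x y \<in> B"
    and "\<exists>n. left_series B n \<subseteq> {0}"
    using nil by (auto simp: nil_subalgebra_def)
  then obtain n where n: "left_series B n \<subseteq> {0}" by blast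
  then have "left_series B n \<subseteq> B"
    using subspace_0[OF B(1)] by auto
  moreover have "\<not> left_series B 0 \<subseteq> B"
    using \<open>B \<noteq> UNIV\<close> by auto
  \<comment> \<open>\<open>Suc k\<close> is the least index whose term lies in \<open>B\<close>; it
    is positive because term 0 is everything.\<close>
  ultimately obtain k where "\<not> left_series B k \<subseteq> B" and k: "left_series B (Suc k) \<subseteq> B"
    using ex_least_nat_less[of "\<lambda>n. left_series B n \<subseteq> B" n] by (metis lessI le_refl)
  then obtain a where a: "a \<in> left_series B k" "a \<notin> B" by blast
  have right: "br b a \<in> B" if "b \<in> B" for b
    using left_series_br[OF that a(1)] k by blast
  \<comment> \<open>Subtract \<open>br b a\<close>, which is in \<open>B\<close>, from the symmetric
    sum, which is in the left kernel.\<close>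
  have left: "br a b \<in> B" if "b \<in> B" for b
    using subspace_diff[OF B(1) _ right[OF that], of "br a b + br b a"] B(2)
      br_anticommute_left_kernel by auto
  define C where "C = span (insert a B)"
  have sub: "insert a B \<subseteq> C" "subspace C"
    by (auto simp: C_def intro: span_base)
  have gen: "br x y \<in> C" if "x \<in> insert a B" "y \<in> insert a B" for x y
  proof -
    have "br a a \<in> B"
      using br_self_left_kernel B(2) by blast
    then have "br x y \<in> B"
      using that B(3) left right by auto
    then show ?thesis
      using sub(1) by blast
  qed
  \<comment> \<open>Closure passes from generators to the span one argument at a time.\<close>
  have "C \<subseteq> {x. br x y \<in> C}" if "y \<in> insert a B" for y
    using gen[OF _ that] unfolding C_def
    by (intro span_minimal subspace_vimage_br_left) auto
  then have "C \<subseteq> {y. br x y \<in> C}" if "x \<in> C" for x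
    using that unfolding C_def by (intro span_minimal subspace_vimage_br) auto
  then have "\<forall>x\<in>C. \<forall>y\<in>C. br x y \<in> C"
    by auto
  moreover obtain m where "left_mult br a ^^ m = (\<lambda>_. 0)"
    using nilp[of a] by (auto simp: nilpotent_op_def)
  then have "left_series C (n * m) \<subseteq> {0}"
    using left_series_span_insert[OF B(1) left] n unfolding C_def by blast
  moreover have "left_kernel \<subseteq> C"
    using sub(1) B(2) by auto
  ultimately have "nil_subalgebra C"
    using sub(2) by (auto simp: nil_subalgebra_def)
  then show thesis
    using that sub(1) a(2) by blast
qed

section \<open>A subalgebra of maximal dimension is the whole algebra\<close>

lemma left_series_eventually_zero:
  assumes "finite_dim scale" and nilp: "\<And>a. nilpotent_op (left_mult br a)"
  obtains n where "left_series UNIV n \<subseteq> {0}"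
proof -
  obtain S where S: "finite S" "span S = UNIV"
    using assms(1) by (auto simp: finite_dim_def)
  define Basis where "Basis = extend_basis {}"
  have Basis: "independent Basis" "span Basis = UNIV"
    unfolding Basis_def using independent_extend_basis span_extend_basis independent_empty by blast+
  interpret finite_dimensional_vector_space scale Basis
    using Basis independent_span_bound[OF S(1), of Basis] S(2) by unfold_locales auto
  have "dim B \<le> dimension" for B
    by (rule dim_subset_UNIV)
  \<comment> \<open>The left kernel shows that candidates exist; \<open>Suc dimension\<close> is a
    strict upper bound for their dimensions.\<close>
  then obtain B where B: "nil_subalgebra B" and max: "\<And>C. nil_subalgebra C \<Longrightarrow> dim C \<le> dim B"
    using ex_has_greatest_nat[of nil_subalgebra _ dim "Suc dimension"] nil_subalgebra_left_kernel
    by (metis le_imp_less_Suc)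
  have "B = UNIV"
  proof (rule ccontr)
    assume "B \<noteq> UNIV"
    then obtain C where C: "nil_subalgebra C" "B \<subset> C"
      using nil_subalgebra_extend[OF B _ nilp] by blast
    then have "span B \<subset> span C"
      using B by (simp add: nil_subalgebra_def span_subspace[OF subset_refl span_superset])
    from dim_psubset[OF this] max[OF C(1)] show False by simp
  qed
  with B that show thesis
    by (auto simp: nil_subalgebra_def)
qed

section \<open>From right-normed products to arbitrary bracketings\<close>

lemma br_left_series_UNIV:
  assumes "x \<in> left_series UNIV m" "y \<in> left_series UNIV n"
  shows "br x y \<in> left_series UNIV (Suc (m + n))"
  using assms
proof (induction m arbitrary: x y n)
  case 0
  then show ?case
    using left_series_br[of x UNIV y n] by simp
next
  case (Suc m)
  have "left_series UNIV (Suc m) \<subseteq> {x. br x y \<in> left_series UNIV (Suc (Suc m + n))}"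
  proof (rule left_series_Suc_subset)
    fix a x assume x: "x \<in> left_series UNIV m"
    have "br a (br x y) \<in> left_series UNIV (Suc (Suc m + n))"
      using left_series_br[OF _ Suc.IH[OF x Suc.prems(2)], of a] by (simp only: UNIV_I add_Suc)
    moreover have "br x (br a y) \<in> left_series UNIV (Suc (Suc m + n))"
      using Suc.IH[OF x left_series_br[OF _ Suc.prems(2)], of a]
      by (simp only: UNIV_I add_Suc add_Suc_right)
    \<comment> \<open>The identity moves \<open>a\<close> out of the left factor; the induction
      hypothesis applies with \<open>y\<close> in term \<open>n\<close> and with
      \<open>br a y\<close> in term \<open>Suc n\<close>.\<close>
    moreover have "br (br a x) y = br a (br x y) - br x (br a y)"
      by (simp add: leibniz_identity[of a x y])
    ultimately show "br a x \<in> {x. br x y \<in> left_series UNIV (Suc (Suc m + n))}"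
      using subspace_diff[OF subspace_left_series] by (simp del: left_series.simps)
  qed (intro subspace_vimage_br_left subspace_left_series)
  with Suc.prems(1) show ?case by blast
qed

text \<open>Term \<open>k\<close> of the series is spanned by right-normed products of
  \<open>k + 1\<close> factors, hence the shift by one.\<close>

lemma product_of_left_series:
  assumes "product_of br n x"
  shows "n > 0 \<and> x \<in> left_series UNIV (n - 1)"
  using assms
proof induction
  case (bracket m x n y)
  then have "m + n - 1 = Suc (m - 1 + (n - 1))" by linarith
  with bracket br_left_series_UNIV[of x "m - 1" y "n - 1"] show ?case
    by (simp only: add_pos_pos)
qed simp

end

theorem corollary4p8:
  fixes scale :: "'a::{alg_closed_field, field_char_0} \<Rightarrow> 'b::ab_group_add \<Rightarrow> 'b"
    and br :: "'b \<Rightarrow> 'b \<Rightarrow> 'b"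
  assumes "leibniz_algebra scale br"
    and "finite_dim scale"
    and "\<And>a. nilpotent_op (left_mult br a)"
  shows "nilpotent_algebra br"
proof -
  interpret leibniz_algebra scale br by fact
  obtain n where "left_series UNIV n \<subseteq> {0}"
    using left_series_eventually_zero assms(2,3) by blast
  then show ?thesis
    unfolding nilpotent_algebra_def using product_of_left_series[of "n + 1"] by fastforce
qed

end
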